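(* Let $X$ be a nonempty locally compact Hausdorff space and let $(Y,d)$ be a metric space with at least two points. The space $MU(X,Y)$ is locally compact if and only if one of the following conditions holds: (i) $Y$ is compact and $X$ is discrete; (ii) $Y$ is discrete and $X$ is compact; (iii) $Y$ is locally compact and $X$ is finite; (iv) $Y$ is finite and $X$ is a topological sum of a compact set and a discrete set. Moreover, the space $MU(X,Y)$ is compact in case (i) and discrete in case (ii).
   Context: A map (multifunction) $F\colon X\to Y$ assigns to each $x\in X$ a subset $F(x)\subseteq Y$; for $A\subseteq X$ put $F(A)=\bigcup_{x\in A}F(x)$. Maps are identified with their graphs $\{(x,y): y\in F(x)\}$. $F$ is upper semicontinuous if for every $x\in X$ and every open $V\supseteq F(x)$ there is an open $U\ni x$ with $F(U)\subseteq V$. $F$ is usco if it is upper semicontinuous and every $F(x)$ is a nonempty compact set. $F$ is minimal usco if it is usco and its graph does not properly contain the graph of any other usco map from $X$ to $Y$. $MU(X,Y)$ is the set of all minimal usco maps from $X$ to $Y$. Let $K(Y)$ be the set of nonempty compact subsets of $Y$, and $H_d$ the Hausdorff metric on $K(Y)$. On $K(Y)^X$ the topology $\tau_{uc}$ of uniform convergence on compact sets is induced by the uniformity $\mathcal U_{uc}$ with base consisting of the sets $W[K,\varepsilon]=\{(F,G): H_d(F(x),G(x))<\varepsilon \text{ for every } x\in K\}$, where $K\subseteq X$ is compact and $\varepsilon>0$. $MU(X,Y)\subseteq K(Y)^X$ carries the subspace topology of $\tau_{uc}$. "$X$ is a topological sum of a compact set and a discrete set" means $X=K\cup D$ with $K,D$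 disjoint open subsets of $X$, $K$ compact and $D$ discrete in the subspace topology (either of them may be empty). *)

theory Defs
  imports "HOL-Analysis.Analysis"
begin

text \<open>The spaces \<open>X\<close> and \<open>Y\<close> are types, and a multifunction is a function
  \<open>'a \<Rightarrow> 'b set\<close>.\<close>

definition multi_graph :: "('a \<Rightarrow> 'b set) \<Rightarrow> ('a \<times> 'b) set" where
  "multi_graph F = {(x, y). y \<in> F x}"

definition upper_semicont :: "('a::topological_space \<Rightarrow> 'b::topological_space set) \<Rightarrow> bool" where
  "upper_semicont F \<longleftrightarrow>
     (\<forall>x V. open V \<and> F x \<subseteq> V \<longrightarrow> (\<exists>U. open U \<and> x \<in> U \<and> (\<Union>u\<in>U. F u) \<subseteq> V))"

definition usco :: "('a::topological_space \<Rightarrow> 'b::topological_space set) \<Rightarrow> bool" where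
  "usco F \<longleftrightarrow> upper_semicont F \<and> (\<forall>x. F x \<noteq> {} \<and> compact (F x))"

definition minimal_usco :: "('a::topological_space \<Rightarrow> 'b::topological_space set) \<Rightarrow> bool" where
  "minimal_usco F \<longleftrightarrow> usco F \<and> \<not> (\<exists>G. usco G \<and> multi_graph G \<subset> multi_graph F)"

definition MU :: "('a::topological_space \<Rightarrow> 'b::topological_space set) set" where
  "MU = {F. minimal_usco F}"

definition compact_valued :: "('a \<Rightarrow> 'b::topological_space set) set" where
  "compact_valued = {F. \<forall>x. F x \<noteq> {} \<and> compact (F x)}"

text \<open>The suprema exist because the definition is only used for nonempty compact sets.\<close>

definition hausdorff_dist :: "'b::metric_space set \<Rightarrow> 'b set \<Rightarrow> real" where
  "hausdorff_dist A B = max (SUP a\<in>A. infdist a B) (SUP b\<in>B. infdist b A)"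

definition uc_basic :: "'a::topological_space set \<Rightarrow> real \<Rightarrow>
    (('a \<Rightarrow> 'b::metric_space set) \<times> ('a \<Rightarrow> 'b set)) set" where
  "uc_basic K \<epsilon> = {(F, G). F \<in> compact_valued \<and> G \<in> compact_valued \<and>
                            (\<forall>x\<in>K. hausdorff_dist (F x) (G x) < \<epsilon>)}"

definition uc_uniformity ::
    "(('a::topological_space \<Rightarrow> 'b::metric_space set) \<times> ('a \<Rightarrow> 'b set)) set set" where
  "uc_uniformity = {E. E \<subseteq> compact_valued \<times> compact_valued \<and>
                       (\<exists>K \<epsilon>. compact K \<and> \<epsilon> > 0 \<and> uc_basic K \<epsilon> \<subseteq> E)}"

definition tau_uc :: "('a::topological_space \<Rightarrow> 'b::metric_space set) topology" where
  "tau_uc = topology (\<lambda>U. U \<subseteq> compact_valued \<and> (\<forall>F\<in>U. \<exists>E\<in>uc_uniformity. E `` {F} \<subseteq> U))"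

definition MU_space :: "('a::topological_space \<Rightarrow> 'b::metric_space set) topology" where
  "MU_space = subtopology tau_uc MU"

definition sum_of_compact_and_discrete :: "'a::topological_space itself \<Rightarrow> bool" where
  "sum_of_compact_and_discrete _ \<longleftrightarrow>
     (\<exists>K D :: 'a set. open K \<and> open D \<and> K \<inter> D = {} \<and> K \<union> D = UNIV \<and>
        compact K \<and> top_of_set D = discrete_topology D)"

lemma uc_uniformity_Int:
  assumes "E1 \<in> uc_uniformity" "E2 \<in> uc_uniformity"
  shows "E1 \<inter> E2 \<in> uc_uniformity"
proof -
  obtain K1 e1 where 1: "compact K1" "e1 > 0" "uc_basic K1 e1 \<subseteq> E1"
    and sub: "E1 \<subseteq> compact_valued \<times> compact_valued"
    using assms(1) unfolding uc_uniformity_def by blast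
  obtain K2 e2 where 2: "compact K2" "e2 > 0" "uc_basic K2 e2 \<subseteq> E2"
    using assms(2) unfolding uc_uniformity_def by blast
  have "uc_basic (K1 \<union> K2) (min e1 e2) \<subseteq> uc_basic K1 e1 \<inter> uc_basic K2 e2"
    unfolding uc_basic_def by fastforce
  then have "uc_basic (K1 \<union> K2) (min e1 e2) \<subseteq> E1 \<inter> E2"
    using 1(3) 2(3) by (meson Int_mono order_trans)
  moreover have "compact (K1 \<union> K2)" "min e1 e2 > 0"
    using 1 2 by (auto intro: compact_Un)
  moreover have "E1 \<inter> E2 \<subseteq> compact_valued \<times> compact_valued"
    using sub by (rule le_infI1)
  ultimately show ?thesis
    unfolding uc_uniformity_def mem_Collect_eq by (intro conjI exI)
qed

lemma openin_tau_uc: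
  "openin tau_uc U \<longleftrightarrow> U \<subseteq> compact_valued \<and> (\<forall>F\<in>U. \<exists>E\<in>uc_uniformity. E `` {F} \<subseteq> U)"
proof -
  have "istopology (\<lambda>U :: ('a \<Rightarrow> 'b set) set. U \<subseteq> compact_valued \<and>
          (\<forall>F\<in>U. \<exists>E\<in>uc_uniformity. E `` {F} \<subseteq> U))"
    unfolding istopology_def
  proof (intro conjI allI impI ballI)
    fix S T :: "('a \<Rightarrow> 'b set) set"
    assume "S \<subseteq> compact_valued \<and> (\<forall>F\<in>S. \<exists>E\<in>uc_uniformity. E `` {F} \<subseteq> S)"
    then show "S \<inter> T \<subseteq> compact_valued"
      by (simp add: le_infI1)
  next
    fix S T :: "('a \<Rightarrow> 'b set) set" and F
    assume S: "S \<subseteq> compact_valued \<and> (\<forall>F\<in>S. \<exists>E\<in>uc_uniformity. E `` {F} \<subseteq> S)"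
      and T: "T \<subseteq> compact_valued \<and> (\<forall>F\<in>T. \<exists>E\<in>uc_uniformity. E `` {F} \<subseteq> T)"
      and F: "F \<in> S \<inter> T"
    from S F obtain E1 where E1: "E1 \<in> uc_uniformity" "E1 `` {F} \<subseteq> S"
      by (meson IntD1)
    from T F obtain E2 where E2: "E2 \<in> uc_uniformity" "E2 `` {F} \<subseteq> T"
      by (meson IntD2)
    have "(E1 \<inter> E2) `` {F} \<subseteq> S \<inter> T"
      using E1(2) E2(2) by blast
    then show "\<exists>E\<in>uc_uniformity. E `` {F} \<subseteq> S \<inter> T"
      using uc_uniformity_Int[OF E1(1) E2(1)] by (rule bexI)
  next
    fix \<K> :: "('a \<Rightarrow> 'b set) set set"
    assume "\<forall>K\<in>\<K>. K \<subseteq> compact_valued \<and> (\<forall>F\<in>K. \<exists>E\<in>uc_uniformity. E `` {F} \<subseteq> K)"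
    then show "\<Union>\<K> \<subseteq> compact_valued"
      by (simp add: Union_least)
  next
    fix \<K> :: "('a \<Rightarrow> 'b set) set set" and F
    assume \<K>: "\<forall>K\<in>\<K>. K \<subseteq> compact_valued \<and> (\<forall>F\<in>K. \<exists>E\<in>uc_uniformity. E `` {F} \<subseteq> K)"
      and "F \<in> \<Union>\<K>"
    then obtain K where K: "K \<in> \<K>" "F \<in> K"
      by (meson UnionE)
    with \<K> obtain E where "E \<in> uc_uniformity" "E `` {F} \<subseteq> K"
      by meson
    then show "\<exists>E\<in>uc_uniformity. E `` {F} \<subseteq> \<Union>\<K>"
      using K(1) by (meson Union_upper order_trans)
  qed
  then show ?thesis
    unfolding tau_uc_def by (subst topology_inverse') (assumption, rule refl)
qed

lemma topspace_tau_uc: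
  "topspace (tau_uc :: ('a::topological_space \<Rightarrow> 'b::metric_space set) topology) = compact_valued"
proof
  let ?C = "compact_valued :: ('a \<Rightarrow> 'b set) set"
  have "?C \<times> ?C \<in> uc_uniformity"
    unfolding uc_uniformity_def mem_Collect_eq
    by (intro conjI subset_refl exI[of _ "{}"] exI[of _ "1::real"]) (auto simp: uc_basic_def)
  moreover have "(?C \<times> ?C) `` {F} \<subseteq> ?C" for F
    by blast
  ultimately have "openin tau_uc ?C"
    unfolding openin_tau_uc by (meson subset_refl)
  then show "?C \<subseteq> topspace tau_uc"
    by (rule openin_subset)
  show "topspace tau_uc \<subseteq> ?C"
    using openin_topspace[of "tau_uc :: ('a \<Rightarrow> 'b set) topology"]
    unfolding openin_tau_uc by (rule conjunct1)
qed

lemma topspace_MU_space: "topspace MU_space = MU"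
  unfolding MU_space_def topspace_subtopology topspace_tau_uc
  by (auto simp: MU_def minimal_usco_def usco_def compact_valued_def)

end

theory Submission
  imports Defs
begin

text \<open>Two kinds of minimal usco maps decide everything. At an isolated point such a map has a
  single value, and this value can be changed at will (\<open>MU_isolated_singleton\<close>,
  \<open>MU_glue_singletons\<close>). At the other extreme, a point \<open>p\<close> and a compact set not containing it
  are always separated by a minimal usco map with values in \<open>{y, z}\<close> (\<open>MU_separating_point\<close>),
  because such a map may jump along the boundary of a regular open set.

  Suppose that \<open>MU_space\<close> is locally compact. A compact neighbourhood of a constant map contains all
  minimal usco maps that are close to the constant on some compact set \<open>K\<close>. A compact family is
  totally bounded uniformly on every compact \<open>L\<close>, while maps that jump between \<open>y\<close> and \<open>z\<close> at
  different places are at distance at least \<open>dist y z\<close>. So only finitely many points of \<open>L\<close> can be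
  separated by members of the family (\<open>finite_if_separated_by_compact_family\<close>). If \<open>Y\<close> is not
  discrete, then \<open>y\<close> and \<open>z\<close> can be taken so close that all separating maps are in the family:
  compact subsets of \<open>X\<close> are finite and \<open>X\<close> is discrete. In general this works off \<open>K\<close>, so that
  \<open>X\<close> is a sum of a compact and a discrete space. Moreover, the values \<open>{y}\<close> that a compact
  family attains at one point stay in a compact part of \<open>Y\<close>
  (\<open>compact_if_singletons_attained\<close>). The constant maps thus show that \<open>Y\<close> is locally compact,
  and if \<open>X\<close> is not compact, a point off \<open>K\<close> shows that \<open>Y\<close> is compact. Deciding whether \<open>Y\<close> is
  discrete and whether \<open>X\<close> is compact leaves exactly the four cases.

  Conversely, if \<open>X\<close> is the sum of a clopen set \<open>K\<close> and isolated points, the minimal usco maps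
  with prescribed restriction to \<open>K\<close> and with values in prescribed compact sets elsewhere form a
  compact family by Tychonoff's theorem (\<open>compactin_glued_singletons\<close>). It is all of \<open>MU\<close> when \<open>X\<close>
  is discrete and \<open>Y\<close> compact, and a neighbourhood of a given map when \<open>X\<close> is finite and \<open>Y\<close>
  locally compact. If \<open>Y\<close> is discrete, an usco map has only finitely many values on a compact
  set \<open>K\<close>, so that maps close to it on \<open>K\<close> coincide with it there. This makes \<open>MU_space\<close> discrete
  if \<open>X\<close> is compact, and it gives the compact neighbourhoods for finite \<open>Y\<close>.\<close>

section \<open>Separation and isolated points\<close>

lemma Hausdorff_space_euclidean_t2: "Hausdorff_space (euclidean :: 'a::t2_space topology)"
  unfolding Hausdorff_space_def disjnt_def open_openin[symmetric] using hausdorff by metis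

lemma t2_separate_compact:
  fixes S T :: "'a::t2_space set"
  assumes "compact S" "compact T" "S \<inter> T = {}"
  obtains U V where "open U" "open V" "S \<subseteq> U" "T \<subseteq> V" "U \<inter> V = {}"
  using Hausdorff_space_compact_separation[OF Hausdorff_space_euclidean_t2, of S T] assms
  by (auto simp: disjnt_def)

lemma euclidean_eq_discrete_iff:
  "(euclidean :: 'a::topological_space topology) = discrete_topology UNIV \<longleftrightarrow> (\<forall>x::'a. open {x})"
  using discrete_topology_unique[of UNIV "euclidean :: 'a topology"] by auto

lemma top_of_set_eq_discrete_iff:
  fixes D :: "'a::topological_space set"
  assumes "open D"
  shows "top_of_set D = discrete_topology D \<longleftrightarrow> (\<forall>x\<in>D. open {x})"
  using discrete_topology_unique[of D "top_of_set D"] assms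
  by (auto simp: openin_open_eq)

lemma locally_compact_nhd:
  assumes "locally_compact_space (euclidean :: 'a::topological_space topology)"
  obtains U C where "open U" "compact C" "(x :: 'a) \<in> U" "U \<subseteq> C"
proof -
  have "\<exists>U C. open U \<and> compact C \<and> x \<in> U \<and> U \<subseteq> C"
    using assms unfolding locally_compact_space_def
    by (simp only: compactin_euclidean_iff open_openin topspace_euclidean UNIV_I ball_UNIV)
  then show thesis using that by blast
qed

lemma open_singleton_if_finite_nhd:
  fixes p :: "'a::t1_space"
  assumes "open U" "finite U" "p \<in> U"
  shows "open {p}"
proof -
  have "open (U - (U - {p}))"
    using assms by (intro open_Diff finite_imp_closed) auto
  moreover have "U - (U - {p}) = {p}" using assms by auto
  ultimately show ?thesis by simp
qed

lemma finite_compact_of_isolated: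
  assumes "compact A" "\<And>x. x \<in> A \<Longrightarrow> open {x}"
  shows "finite A"
proof -
  obtain A' where "A' \<subseteq> A" "finite A'" "A \<subseteq> (\<Union>x\<in>A'. {x})"
    using compactE_image[OF assms(1), of A "\<lambda>x. {x}"] assms(2) by auto
  then show ?thesis by (auto intro: finite_subset)
qed

section \<open>Usco and minimal usco maps\<close>

lemma usco_nonempty: "usco F \<Longrightarrow> F x \<noteq> {}"
  and usco_compact: "usco F \<Longrightarrow> compact (F x)"
  by (auto simp: usco_def)

lemma usco_nhd:
  assumes "usco F" "open V" "F x \<subseteq> V"
  obtains U where "open U" "x \<in> U" "\<And>u. u \<in> U \<Longrightarrow> F u \<subseteq> V"
proof -
  obtain U where "open U" "x \<in> U" "(\<Union>u\<in>U. F u) \<subseteq> V"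
    using assms unfolding usco_def upper_semicont_def by metis
  then show thesis using that[of U] by (simp add: UN_subset_iff)
qed

lemma uscoI:
  assumes "\<And>x. F x \<noteq> {}" "\<And>x. compact (F x)"
    and "\<And>x V. \<lbrakk>open V; F x \<subseteq> V\<rbrakk> \<Longrightarrow> \<exists>U. open U \<and> x \<in> U \<and> (\<forall>u\<in>U. F u \<subseteq> V)"
  shows "usco F"
  unfolding usco_def upper_semicont_def using assms by (simp add: UN_subset_iff)

lemma compact_usco_image:
  assumes F: "usco F" and K: "compact K"
  shows "compact (\<Union>x\<in>K. F x)"
proof (rule compactI)
  fix \<C> assume op: "\<forall>t\<in>\<C>. open t" and cov: "(\<Union>x\<in>K. F x) \<subseteq> \<Union>\<C>"
  have "\<exists>\<D>. \<D> \<subseteq> \<C> \<and> finite \<D> \<and> F x \<subseteq> \<Union>\<D>" if "x \<in> K" for x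
    using compactE[OF usco_compact[OF F, of x], of \<C>] op cov that by (metis UN_subset_iff)
  then obtain \<D> where \<D>: "\<And>x. x \<in> K \<Longrightarrow> \<D> x \<subseteq> \<C> \<and> finite (\<D> x) \<and> F x \<subseteq> \<Union>(\<D> x)"
    by metis
  have "\<exists>U. open U \<and> x \<in> U \<and> (\<forall>u\<in>U. F u \<subseteq> \<Union>(\<D> x))" if "x \<in> K" for x
    using usco_nhd[OF F, of "\<Union>(\<D> x)" x] \<D>[OF that] op by (metis open_Union subsetD)
  then obtain U where U: "\<And>x. x \<in> K \<Longrightarrow> open (U x) \<and> x \<in> U x \<and> (\<forall>u\<in>U x. F u \<subseteq> \<Union>(\<D> x))"
    by metis
  obtain K' where K': "K' \<subseteq> K" "finite K'" "K \<subseteq> (\<Union>x\<in>K'. U x)"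
    using compactE_image[OF K, of K U] U by (metis UN_I subsetI)
  show "\<exists>\<C>'\<subseteq>\<C>. finite \<C>' \<and> (\<Union>x\<in>K. F x) \<subseteq> \<Union>\<C>'"
  proof (intro exI conjI)
    show "(\<Union>x\<in>K'. \<D> x) \<subseteq> \<C>" using \<D> K'(1) by blast
    show "finite (\<Union>x\<in>K'. \<D> x)" using \<D> K' by blast
    show "(\<Union>x\<in>K. F x) \<subseteq> \<Union>(\<Union>x\<in>K'. \<D> x)"
    proof
      fix y assume "y \<in> (\<Union>x\<in>K. F x)"
      then obtain x where "x \<in> K" "y \<in> F x" by blast
      then obtain z where "z \<in> K'" "x \<in> U z" using K'(3) by blast
      then have "y \<in> \<Union>(\<D> z)" using U[of z] K'(1) \<open>y \<in> F x\<close> by blast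
      then show "y \<in> \<Union>(\<Union>x\<in>K'. \<D> x)" using \<open>z \<in> K'\<close> by blast
    qed
  qed
qed

lemma usco_glue_clopen:
  assumes K: "open K" "closed K" and F: "usco F" and G: "usco G"
  shows "usco (\<lambda>x. if x \<in> K then F x else G x)"
proof (rule uscoI)
  fix x V assume V: "open V" "(if x \<in> K then F x else G x) \<subseteq> V"
  show "\<exists>U. open U \<and> x \<in> U \<and> (\<forall>u\<in>U. (if u \<in> K then F u else G u) \<subseteq> V)"
  proof (cases "x \<in> K")
    case True
    then obtain U where U: "open U" "x \<in> U" "\<And>u. u \<in> U \<Longrightarrow> F u \<subseteq> V"
      using usco_nhd[OF F V(1), of x] V(2) by auto
    show ?thesis
      by (rule exI[of _ "U \<inter> K"]) (use U K True in auto)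
  next
    case False
    then obtain U where U: "open U" "x \<in> U" "\<And>u. u \<in> U \<Longrightarrow> G u \<subseteq> V"
      using usco_nhd[OF G V(1), of x] V(2) by auto
    show ?thesis
      by (rule exI[of _ "U - K"]) (use U K False in auto)
  qed
qed (use F G in \<open>auto simp: usco_def\<close>)

lemma multi_graph_subset_iff: "multi_graph G \<subseteq> multi_graph F \<longleftrightarrow> (\<forall>x. G x \<subseteq> F x)"
  by (auto simp: multi_graph_def)

lemma MU_iff: "F \<in> MU \<longleftrightarrow> usco F \<and> (\<forall>G. usco G \<and> (\<forall>x. G x \<subseteq> F x) \<longrightarrow> G = F)"
proof -
  have eq: "multi_graph G = multi_graph F \<longleftrightarrow> G = F" for G
    by (auto simp: multi_graph_def fun_eq_iff)
  show ?thesis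
    unfolding MU_def minimal_usco_def psubset_eq multi_graph_subset_iff eq mem_Collect_eq
    by blast
qed

lemma MU_usco: "F \<in> MU \<Longrightarrow> usco F"
  and MU_minimal: "\<lbrakk>F \<in> MU; usco G; \<And>x. G x \<subseteq> F x\<rbrakk> \<Longrightarrow> G = F"
  by (auto simp: MU_iff)

lemma MU_subset_compact_valued: "MU \<subseteq> compact_valued"
  by (auto simp: MU_iff usco_def compact_valued_def)

text \<open>If \<open>F\<close> is locally squeezed into every neighbourhood of each of its values, then a smaller
  usco map \<open>G\<close> cannot omit a value \<open>y\<close> of \<open>F x\<close>: near \<open>x\<close> it would stay away from \<open>y\<close>, while
  at some point near \<open>x\<close> all of \<open>F\<close> is close to \<open>y\<close>.\<close>

lemma MU_if_squeezed:
  fixes F :: "'a::topological_space \<Rightarrow> 'b::t2_space set"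
  assumes F: "usco F"
    and sq: "\<And>x y N W. \<lbrakk>y \<in> F x; open N; x \<in> N; open W; y \<in> W\<rbrakk> \<Longrightarrow> \<exists>u\<in>N. F u \<subseteq> W"
  shows "F \<in> MU"
proof -
  have "F x \<subseteq> G x" if G: "usco G" and sub: "\<And>x. G x \<subseteq> F x" for G x
  proof
    fix y assume y: "y \<in> F x"
    show "y \<in> G x"
    proof (rule ccontr)
      assume "y \<notin> G x"
      then obtain W V where WV: "open W" "open V" "y \<in> W" "G x \<subseteq> V" "W \<inter> V = {}"
        using t2_separate_compact[of "{y}" "G x"] usco_compact[OF G] by auto
      obtain N where N: "open N" "x \<in> N" "\<And>u. u \<in> N \<Longrightarrow> G u \<subseteq> V"
        using usco_nhd[OF G \<open>open V\<close> \<open>G x \<subseteq> V\<close>] by blast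
      obtain u where "u \<in> N" "F u \<subseteq> W"
        using sq[OF y N(1,2) WV(1,3)] by blast
      then have "G u \<subseteq> W \<inter> V" using N(3) sub by blast
      then show False using WV(5) usco_nonempty[OF G] by auto
    qed
  qed
  then show ?thesis using F by (auto simp: MU_iff fun_eq_iff)
qed

lemma const_singleton_MU: "(\<lambda>_. {y :: 'b::t2_space}) \<in> MU"
  by (rule MU_if_squeezed) (auto intro!: uscoI)

text \<open>A minimal usco map into \<open>{y, z}\<close> that plays the role of a Urysohn function. No continuity
  has to be arranged: for a regular open set \<open>U\<close> the map may take the value \<open>y\<close> on \<open>U\<close>, the
  value \<open>z\<close> on the exterior of \<open>U\<close>, and both values on the common boundary. A set separating
  \<open>p\<close> from \<open>K\<close> exists in every Hausdorff space, and it becomes regular open by passing to the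
  interior of its closure.\<close>

lemma MU_separating_point:
  fixes K :: "'a::t2_space set" and y z :: "'b::t2_space"
  assumes K: "compact K" and p: "p \<notin> K"
  obtains F where "F \<in> MU" "F p = {y}" "\<And>x. x \<in> K \<Longrightarrow> F x = {z}" "\<And>x. F x \<subseteq> {y, z}"
proof -
  obtain U V where UV: "open U" "open V" "p \<in> U" "K \<subseteq> V" "U \<inter> V = {}"
    using t2_separate_compact[of "{p}" K] K p by auto
  define A where "A = closure U"
  define B where "B = closure (- A)"
  define F where "F = (\<lambda>x. (if x \<in> A then {y} else {}) \<union> (if x \<in> B then {z} else {}))"
  have cl: "closed A" "closed B" and AB: "A \<union> B = UNIV"
    unfolding A_def B_def using closure_subset[of "- closure U"] by auto
  have UB: "U \<inter> B = {}"
    using \<open>open U\<close> closure_subset[of U] unfolding B_def A_def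
    by (metis Compl_disjoint inf.absorb_iff1 inf_assoc inf_bot_right open_Int_closure_eq_empty)
  have VA: "V \<inter> A = {}"
    using UV unfolding A_def by (simp add: Int_commute open_Int_closure_eq_empty)
  have ne: "F x \<noteq> {}" for x using AB unfolding F_def by auto
  have usco: "usco F"
  proof (rule uscoI)
    fix x W assume "open W" and W: "F x \<subseteq> W"
    \<comment> \<open>Drop the closed piece \<open>A\<close> or \<open>B\<close> of the domain whose value is not in \<open>W\<close>.\<close>
    let ?N = "(if y \<in> W then UNIV else - A) \<inter> (if z \<in> W then UNIV else - B)"
    have "open ?N" using cl by auto
    moreover have "x \<in> ?N" using W unfolding F_def by (auto split: if_splits)
    moreover have "\<forall>u\<in>?N. F u \<subseteq> W" unfolding F_def by (auto split: if_splits)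
    ultimately show "\<exists>N. open N \<and> x \<in> N \<and> (\<forall>u\<in>N. F u \<subseteq> W)" by blast
  qed (use ne in \<open>auto simp: F_def\<close>)
  have "F \<in> MU"
  proof (rule MU_if_squeezed[OF usco])
    fix x v N W assume v: "v \<in> F x" and N: "open N" "x \<in> N" and W: "open W" "v \<in> W"
    consider "v = y" "x \<in> A" | "v = z" "x \<in> B"
      using v unfolding F_def by (auto split: if_splits)
    then show "\<exists>u\<in>N. F u \<subseteq> W"
    proof cases
      case 1
      then obtain u where "u \<in> N" "u \<in> U"
        using N open_Int_closure_eq_empty[of N U] unfolding A_def by blast
      then show ?thesis using UB W 1 unfolding F_def by (intro bexI[of _ u]) auto
    next
      case 2
      then obtain u where "u \<in> N" "u \<notin> A"
        using N open_Int_closure_eq_empty[of N "- A"] unfolding B_def by blast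
      then show ?thesis using W 2 unfolding F_def by (intro bexI[of _ u]) auto
    qed
  qed
  moreover have "F p = {y}"
    using UV(3) UB closure_subset[of U] unfolding F_def A_def by auto
  moreover have "F x = {z}" if "x \<in> K" for x
    using that UV(4) VA AB unfolding F_def by auto
  moreover have "F x \<subseteq> {y, z}" for x unfolding F_def by auto
  ultimately show thesis by (rule that)
qed

text \<open>Shrinking the value at an isolated point to one of its elements leaves the map usco.\<close>

lemma MU_isolated_singleton:
  fixes F :: "'a::t1_space \<Rightarrow> 'b::topological_space set"
  assumes F: "F \<in> MU" and x: "open {x}"
  obtains y where "F x = {y}"
proof -
  obtain y where y: "y \<in> F x" using usco_nonempty[OF MU_usco[OF F]] by blast
  have const: "usco (\<lambda>_. {y})" by (rule uscoI) auto
  let ?G = "\<lambda>u. if u \<in> {x} then {y} else F u"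
  have "?G = F"
    using y by (intro MU_minimal[OF F] usco_glue_clopen x const MU_usco[OF F]) auto
  from fun_cong[OF this, of x] have "F x = {y}" by simp
  then show thesis by (rule that)
qed

text \<open>A smaller usco map is compared with \<open>F\<close> by extending its restriction to \<open>K\<close> by \<open>F\<close>; off \<open>K\<close>
  the values are singletons and cannot shrink.\<close>

lemma MU_glue_singletons:
  fixes F :: "'a::t1_space \<Rightarrow> 'b::topological_space set"
  assumes F: "F \<in> MU" and K: "open K" "closed K" and D: "\<And>x. x \<notin> K \<Longrightarrow> open {x}"
  shows "(\<lambda>x. if x \<in> K then F x else {g x}) \<in> MU"
proof -
  have g: "usco (\<lambda>x. if x \<in> K then F x else {g x})"
  proof (rule uscoI)
    fix x V assume V: "open V" "(if x \<in> K then F x else {g x}) \<subseteq> V"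
    show "\<exists>U. open U \<and> x \<in> U \<and> (\<forall>u\<in>U. (if u \<in> K then F u else {g u}) \<subseteq> V)"
    proof (cases "x \<in> K")
      case True
      then obtain U where U: "open U" "x \<in> U" "\<And>u. u \<in> U \<Longrightarrow> F u \<subseteq> V"
        using usco_nhd[OF MU_usco[OF F] V(1), of x] V(2) by auto
      show ?thesis by (rule exI[of _ "U \<inter> K"]) (use U K True in auto)
    next
      case False
      show ?thesis by (rule exI[of _ "{x}"]) (use D[OF False] V in auto)
    qed
  qed (use MU_usco[OF F] in \<open>auto simp: usco_def\<close>)
  have "G = (\<lambda>x. if x \<in> K then F x else {g x})"
    if G: "usco G" and sub: "\<And>x. G x \<subseteq> (if x \<in> K then F x else {g x})" for G
  proof -
    have "G x \<subseteq> F x" if "x \<in> K" for x using sub[of x] that by simp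
    then have GF: "(\<lambda>x. if x \<in> K then G x else F x) = F"
      by (intro MU_minimal[OF F] usco_glue_clopen K G MU_usco[OF F]) auto
    have "G x = F x" if "x \<in> K" for x using fun_cong[OF GF, of x] that by simp
    moreover have "G x = {g x}" if "x \<notin> K" for x
      using sub[of x] that usco_nonempty[OF G, of x] by auto
    ultimately show ?thesis by (simp add: fun_eq_iff)
  qed
  then show ?thesis using g unfolding MU_iff by blast
qed

section \<open>The Hausdorff distance and uniform convergence on compact sets\<close>

lemma hausdorff_dist_less_iff:
  fixes A B :: "'b::metric_space set"
  assumes "A \<noteq> {}" "B \<noteq> {}" "compact A" "compact B"
  shows "hausdorff_dist A B < e \<longleftrightarrow>
    (\<forall>a\<in>A. \<exists>b\<in>B. dist a b < e) \<and> (\<forall>b\<in>B. \<exists>a\<in>A. dist b a < e)"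
proof -
  have inf: "infdist a B < e \<longleftrightarrow> (\<exists>b\<in>B. dist a b < e)" if "B \<noteq> {}" for a :: 'b and B
    unfolding infdist_notempty[OF that] using that by (subst cINF_less_iff) auto
  have "(SUP a\<in>A. infdist a B) < e \<longleftrightarrow> (\<forall>a\<in>A. infdist a B < e)"
    if AB: "A \<noteq> {}" "compact A" for A B :: "'b set"
  proof -
    have "continuous_on A (\<lambda>x. infdist x B)" by (intro continuous_intros)
    then obtain a where a: "a \<in> A" "\<forall>b\<in>A. infdist b B \<le> infdist a B"
      using continuous_attains_sup[OF AB(2,1)] by blast
    then have "(SUP a\<in>A. infdist a B) = infdist a B"
      by (intro cSup_eq_maximum) auto
    then show ?thesis using a by fastforce
  qed
  then show ?thesis
    unfolding hausdorff_dist_def using assms by (simp add: inf)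
qed

lemma hausdorff_dist_triangle_less:
  assumes "A \<noteq> {}" "B \<noteq> {}" "C \<noteq> {}" "compact A" "compact B" "compact C"
    and AB: "hausdorff_dist A B < r" and BC: "hausdorff_dist B C < s"
  shows "hausdorff_dist A C < r + s"
proof -
  have "\<exists>c\<in>C. dist a c < r + s" if a: "a \<in> A" for a
  proof -
    obtain b where "b \<in> B" "dist a b < r"
      using AB a by (auto simp: hausdorff_dist_less_iff assms(1-6))
    then obtain c where "c \<in> C" "dist b c < s"
      using BC by (auto simp: hausdorff_dist_less_iff assms(1-6))
    then show ?thesis using \<open>dist a b < r\<close> dist_triangle[of a c b] by (intro bexI[of _ c]) auto
  qed
  moreover have "\<exists>a\<in>A. dist c a < r + s" if c: "c \<in> C" for c
  proof -
    obtain b where "b \<in> B" "dist c b < s"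
      using BC c by (auto simp: hausdorff_dist_less_iff assms(1-6))
    then obtain a where "a \<in> A" "dist b a < r"
      using AB by (auto simp: hausdorff_dist_less_iff assms(1-6))
    then show ?thesis using \<open>dist c b < s\<close> dist_triangle[of c a b] by (intro bexI[of _ a]) auto
  qed
  ultimately show ?thesis by (simp add: hausdorff_dist_less_iff assms(1-6))
qed

lemma hausdorff_dist_singleton_less_iff:
  assumes "A \<noteq> {}" "compact A"
  shows "hausdorff_dist A {y} < e \<longleftrightarrow> (\<forall>a\<in>A. dist a y < e)"
  using assms by (subst hausdorff_dist_less_iff) (auto simp: dist_commute)

lemma hausdorff_dist_self_less:
  assumes "A \<noteq> {}" "compact A" "e > 0"
  shows "hausdorff_dist A A < e"
  using assms by (subst hausdorff_dist_less_iff) (auto intro!: bexI)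

lemma uc_basic_iff:
  assumes "F \<in> compact_valued" "G \<in> compact_valued"
  shows "(F, G) \<in> uc_basic K e \<longleftrightarrow> (\<forall>x\<in>K. hausdorff_dist (F x) (G x) < e)"
  using assms by (simp add: uc_basic_def)

lemma openin_tau_uc_iff:
  "openin tau_uc U \<longleftrightarrow> U \<subseteq> compact_valued \<and>
     (\<forall>F\<in>U. \<exists>K e. compact K \<and> e > 0 \<and> (\<forall>G. (F, G) \<in> uc_basic K e \<longrightarrow> G \<in> U))"
    (is "_ \<longleftrightarrow> ?S \<and> (\<forall>F\<in>U. ?P F)")
proof -
  have "(\<exists>E\<in>uc_uniformity. E `` {F} \<subseteq> U) \<longleftrightarrow> ?P F" for F
  proof
    assume "\<exists>E\<in>uc_uniformity. E `` {F} \<subseteq> U"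
    then show "?P F" unfolding uc_uniformity_def by blast
  next
    assume "?P F"
    then obtain K e where "compact K" "e > 0" "uc_basic K e `` {F} \<subseteq> U" by blast
    moreover have "uc_basic K e \<subseteq> compact_valued \<times> compact_valued"
      by (auto simp: uc_basic_def)
    ultimately show "\<exists>E\<in>uc_uniformity. E `` {F} \<subseteq> U"
      unfolding uc_uniformity_def by blast
  qed
  then show ?thesis unfolding openin_tau_uc by simp
qed

text \<open>The ball \<open>uc_basic K e `` {F}\<close> need not be open when \<open>K\<close> is infinite, because the
  distances on \<open>K\<close> may come arbitrarily close to \<open>e\<close>. Bounding them away from \<open>e\<close> gives an
  open set.\<close>

lemma openin_tau_uc_ball:
  assumes "compact K"
  shows "openin tau_uc {G \<in> compact_valued. \<exists>s<e. (F, G) \<in> uc_basic K s}" (is "openin _ ?O")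
  unfolding openin_tau_uc_iff
proof (intro conjI ballI)
  fix G assume "G \<in> ?O"
  then obtain s where s: "s < e" "(F, G) \<in> uc_basic K s" and G: "G \<in> compact_valued" by blast
  have F: "F \<in> compact_valued" using s(2) by (simp add: uc_basic_def)
  define r where "r = (e - s) / 2"
  have "H \<in> ?O" if H: "(G, H) \<in> uc_basic K r" for H
  proof -
    have H': "H \<in> compact_valued" using H by (simp add: uc_basic_def)
    have "hausdorff_dist (F x) (H x) < s + r" if "x \<in> K" for x
      using F G H' s(2) H that
      by (intro hausdorff_dist_triangle_less[of _ "G x"]) (auto simp: uc_basic_def compact_valued_def)
    moreover have "s + r < e" using s(1) unfolding r_def by (simp add: field_simps)
    ultimately show ?thesis using F H' by (auto simp: uc_basic_iff)
  qed
  then show "\<exists>K e. compact K \<and> e > 0 \<and> (\<forall>H. (G, H) \<in> uc_basic K e \<longrightarrow> H \<in> ?O)"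
    using assms s(1) by (intro exI[of _ K] exI[of _ r]) (auto simp: r_def)
qed auto

lemma uc_basic_refl:
  assumes "F \<in> compact_valued" "e > 0"
  shows "(F, F) \<in> uc_basic K e"
  using assms by (auto simp: uc_basic_def compact_valued_def intro: hausdorff_dist_self_less)

lemma openin_MU_space_ball:
  assumes F: "F \<in> MU" and K: "compact K" and e: "e > 0"
  obtains U where "openin MU_space U" "F \<in> U" "\<And>G. G \<in> U \<Longrightarrow> G \<in> MU \<and> (F, G) \<in> uc_basic K e"
proof -
  let ?O = "{G \<in> compact_valued. \<exists>s<e. (F, G) \<in> uc_basic K s}"
  have F': "F \<in> compact_valued" using F MU_subset_compact_valued by blast
  have "openin MU_space (MU \<inter> ?O)"
    unfolding MU_space_def using openin_tau_uc_ball[OF K] by (auto simp: openin_subtopology)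
  moreover have "F \<in> MU \<inter> ?O"
    using F F' e uc_basic_refl[OF F', of "e/2" K] by (auto intro!: exI[of _ "e/2"])
  moreover have "G \<in> MU \<and> (F, G) \<in> uc_basic K e" if "G \<in> MU \<inter> ?O" for G
    using that by (fastforce simp: uc_basic_def)
  ultimately show thesis by (rule that)
qed

text \<open>A compact family of maps is totally bounded, even with a radius depending on the centre.\<close>

lemma compactin_tau_uc_net:
  assumes \<C>: "compactin tau_uc \<C>" and K: "compact K" and r: "\<And>G. G \<in> \<C> \<Longrightarrow> r G > 0"
  obtains \<G> where "finite \<G>" "\<G> \<subseteq> \<C>" "\<And>F. F \<in> \<C> \<Longrightarrow> \<exists>G\<in>\<G>. (G, F) \<in> uc_basic K (r G)"
proof -
  define N where "N = (\<lambda>G. {F \<in> compact_valued. \<exists>s<r G. (G, F) \<in> uc_basic K s})"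
  have sub: "\<C> \<subseteq> compact_valued"
    using \<C> compactin_subset_topspace topspace_tau_uc by blast
  have "openin tau_uc (N G)" for G unfolding N_def by (rule openin_tau_uc_ball[OF K])
  moreover have "\<C> \<subseteq> \<Union>(N ` \<C>)"
  proof
    fix G assume G: "G \<in> \<C>"
    then have "G \<in> N G"
      using sub r uc_basic_refl[of G "r G / 2" K] unfolding N_def
      by (auto intro!: exI[of _ "r G / 2"])
    then show "G \<in> \<Union>(N ` \<C>)" using G by blast
  qed
  ultimately obtain \<F> where "finite \<F>" "\<F> \<subseteq> N ` \<C>" "\<C> \<subseteq> \<Union>\<F>"
    using compactinD[OF \<C>, of "N ` \<C>"] by blast
  then obtain \<G> where \<G>: "finite \<G>" "\<G> \<subseteq> \<C>" "\<F> = N ` \<G>"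
    by (metis finite_subset_image)
  have "\<exists>G\<in>\<G>. (G, F) \<in> uc_basic K (r G)" if F: "F \<in> \<C>" for F
  proof -
    obtain G where "G \<in> \<G>" "F \<in> N G" using F \<open>\<C> \<subseteq> \<Union>\<F>\<close> \<G>(3) by blast
    then show ?thesis unfolding N_def by (fastforce simp: uc_basic_def)
  qed
  then show thesis using that \<G> by blast
qed

section \<open>What compact families of maps force on the two spaces\<close>

text \<open>A compact family of compact-valued maps has a compact set of values at \<open>x\<close> with respect to
  the Hausdorff metric; the singletons among these values carry the topology of \<open>Y\<close>. The
  argument lifts an open cover of \<open>A\<close> to the family: a single point of the value \<open>G x\<close> controls
  all singletons close to \<open>G x\<close>.\<close>

lemma compact_if_singletons_attained:
  fixes A :: "'b::metric_space set" and \<C> :: "('a::topological_space \<Rightarrow> 'b set) set"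
  assumes \<C>: "compactin tau_uc \<C>" and A: "closed A"
    and att: "\<And>y. y \<in> A \<Longrightarrow> \<exists>F\<in>\<C>. F x = {y}"
  shows "compact A"
proof (rule compactI)
  fix \<O> assume op: "\<forall>t\<in>\<O>. open t" and cov: "A \<subseteq> \<Union>\<O>"
  have cv: "\<C> \<subseteq> compact_valued"
    using \<C> compactin_subset_topspace topspace_tau_uc by blast
  \<comment> \<open>If \<open>b\<close> lies off \<open>A\<close>, a small ball around it misses \<open>A\<close>, and no member of the cover is needed:
    then \<open>N\<close> is the empty set, which is intersected away below.\<close>
  have "\<exists>b e N. b \<in> G x \<and> e > 0 \<and> ball b e \<inter> A \<subseteq> N \<and> (N \<in> \<O> \<or> N = {})" if G: "G \<in> \<C>" for G
  proof -
    obtain b where b: "b \<in> G x" using G cv unfolding compact_valued_def by blast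
    show ?thesis
    proof (cases "b \<in> A")
      case True
      then obtain N where "N \<in> \<O>" "b \<in> N" using cov by blast
      then obtain e where "e > 0" "ball b e \<subseteq> N" using op open_contains_ball by meson
      then show ?thesis using b \<open>N \<in> \<O>\<close> by blast
    next
      case False
      then obtain e where "e > 0" "ball b e \<subseteq> - A"
        using A open_contains_ball[of "- A"] by auto
      then show ?thesis using b by (intro exI[of _ b] exI[of _ e] exI[of _ "{}"]) auto
    qed
  qed
  then obtain b e N where beO: "\<And>G. G \<in> \<C> \<Longrightarrow>
      b G \<in> G x \<and> e G > 0 \<and> ball (b G) (e G) \<inter> A \<subseteq> N G \<and> (N G \<in> \<O> \<or> N G = {})"
    by metis
  obtain \<G> where \<G>: "finite \<G>" "\<G> \<subseteq> \<C>"
    and net: "\<And>F. F \<in> \<C> \<Longrightarrow> \<exists>G\<in>\<G>. (G, F) \<in> uc_basic {x} (e G)"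
    using compactin_tau_uc_net[OF \<C>, of "{x}" e] beO by auto
  show "\<exists>\<O>'\<subseteq>\<O>. finite \<O>' \<and> A \<subseteq> \<Union>\<O>'"
  proof (intro exI[of _ "N ` \<G> \<inter> \<O>"] conjI subsetI)
    fix y assume y: "y \<in> A"
    then obtain F where F: "F \<in> \<C>" "F x = {y}" using att by blast
    then obtain G where G: "G \<in> \<G>" "(G, F) \<in> uc_basic {x} (e G)" using net by blast
    then have "G \<in> \<C>" using \<G> by blast
    have "dist (b G) y < e G"
      using G(2) F(2) beO[OF \<open>G \<in> \<C>\<close>] cv \<open>G \<in> \<C>\<close>
      by (auto simp: uc_basic_def compact_valued_def hausdorff_dist_singleton_less_iff)
    then have "y \<in> N G" using beO[OF \<open>G \<in> \<C>\<close>] y by auto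
    then show "y \<in> \<Union>(N ` \<G> \<inter> \<O>)" using beO[OF \<open>G \<in> \<C>\<close>] G(1) by blast
  qed (use \<G> in auto)
qed

text \<open>Two maps that take the values \<open>{y}\<close> and \<open>{z}\<close> at the same point of \<open>L\<close> are at distance at
  least \<open>dist y z\<close>, hence cannot both be within half of that distance from a common centre. So
  every point \<open>p\<close> of \<open>P\<close> in \<open>L\<close> is determined by the set of those centres of a finite net that are
  close to a map with value \<open>{y}\<close> at \<open>p\<close>, and there are only finitely many such sets.\<close>

lemma finite_if_separated_by_compact_family:
  fixes P L :: "'a::topological_space set" and y z :: "'b::metric_space"
  assumes \<C>: "compactin tau_uc \<C>" and L: "compact L" and yz: "y \<noteq> z"
    and sep: "\<And>p q. \<lbrakk>p \<in> P; q \<in> P; p \<noteq> q\<rbrakk> \<Longrightarrow> \<exists>F\<in>\<C>. F p = {y} \<and> F q = {z}"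
  shows "finite (L \<inter> P)"
proof -
  define r where "r = dist y z / 2"
  have r: "r > 0" using yz unfolding r_def by simp
  have cv: "\<C> \<subseteq> compact_valued"
    using \<C> compactin_subset_topspace topspace_tau_uc by blast
  obtain \<G> where \<G>: "finite \<G>" "\<G> \<subseteq> \<C>"
    and net: "\<And>F. F \<in> \<C> \<Longrightarrow> \<exists>G\<in>\<G>. (G, F) \<in> uc_basic L r"
    using compactin_tau_uc_net[OF \<C> L, of "\<lambda>_. r"] r by auto
  \<comment> \<open>The finite label of \<open>p\<close> that tells the points of \<open>L \<inter> P\<close> apart.\<close>
  define S where "S = (\<lambda>p. {G \<in> \<G>. \<exists>F\<in>\<C>. (G, F) \<in> uc_basic L r \<and> F p = {y}})"
  have "S p \<noteq> S q" if p: "p \<in> L \<inter> P" and q: "q \<in> L \<inter> P" and pq: "p \<noteq> q" for p q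
  proof
    assume eq: "S p = S q"
    obtain F where F: "F \<in> \<C>" "F p = {y}" "F q = {z}" using sep[of p q] p q pq by blast
    then obtain G where G: "G \<in> \<G>" "(G, F) \<in> uc_basic L r" using net by blast
    then have "G \<in> S q" using F eq unfolding S_def by blast
    then obtain F' where F': "(G, F') \<in> uc_basic L r" "F' q = {y}" unfolding S_def by blast
    have Gq: "G q \<noteq> {}" "compact (G q)"
      using G(1) \<G>(2) cv by (auto simp: compact_valued_def)
    have "\<forall>a\<in>G q. dist a z < r" "\<forall>a\<in>G q. dist a y < r"
      using G(2) F(3) F' q unfolding uc_basic_def
      by (auto simp: Gq simp flip: hausdorff_dist_singleton_less_iff)
    then obtain a where "dist a z < r" "dist a y < r" using Gq(1) by blast
    then have "dist y z < r + r"
      by (metis add_strict_mono dist_commute dist_triangle order_le_less_trans)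
    then show False unfolding r_def by simp
  qed
  then have "inj_on S (L \<inter> P)" unfolding inj_on_def by blast
  moreover have "S ` (L \<inter> P) \<subseteq> Pow \<G>" unfolding S_def by auto
  ultimately show ?thesis
    using \<G>(1) by (meson finite_Pow_iff finite_imageD finite_subset)
qed

section \<open>Compact families of minimal usco maps\<close>

text \<open>On the isolated points off \<open>K\<close> a minimal usco map is an ordinary function, with no condition
  linking its values, while a compact set contains only finitely many of these points. So with
  the values on \<open>K\<close> prescribed, the topology of uniform convergence on compact sets is that of a
  product, and Tychonoff's theorem applies.\<close>

lemma compactin_glued_singletons:
  fixes F :: "'a::t2_space \<Rightarrow> 'b::metric_space set"
  assumes F: "F \<in> MU" and K: "open K" "closed K" and D: "\<And>x. x \<notin> K \<Longrightarrow> open {x}"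
    and C: "\<And>x. x \<notin> K \<Longrightarrow> compact (C x)"
  shows "compactin MU_space ((\<lambda>g x. if x \<in> K then F x else {g x}) ` PiE (- K) C)"
proof -
  let ?\<Phi> = "\<lambda>g x. if x \<in> K then F x else {g x}"
  let ?P = "product_topology (\<lambda>_. euclidean :: 'b topology) (- K)"
  have MU: "?\<Phi> g \<in> MU" for g by (rule MU_glue_singletons[OF F K D])
  then have cv: "?\<Phi> g \<in> compact_valued" for g using MU_subset_compact_valued by blast
  have "continuous_map ?P tau_uc ?\<Phi>"
    unfolding continuous_map topspace_tau_uc
  proof (intro conjI allI impI)
    show "?\<Phi> ` topspace ?P \<subseteq> compact_valued" using cv by blast
    fix U :: "('a \<Rightarrow> 'b set) set" assume U: "openin tau_uc U"
    show "openin ?P {g \<in> topspace ?P. ?\<Phi> g \<in> U}"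
    proof (subst openin_subopen, intro ballI)
      fix g assume "g \<in> {g \<in> topspace ?P. ?\<Phi> g \<in> U}"
      then have g: "g \<in> topspace ?P" "?\<Phi> g \<in> U" by auto
      obtain L e where L: "compact L" and e: "e > 0"
        and LU: "\<And>G. (?\<Phi> g, G) \<in> uc_basic L e \<Longrightarrow> G \<in> U"
        using U g(2) unfolding openin_tau_uc_iff by meson
      have fin: "finite (L - K)"
        using L K D by (intro finite_compact_of_isolated compact_diff) auto
      let ?B = "\<lambda>x. if x \<in> L then ball (g x) e else UNIV"
      have "{x \<in> - K. ?B x \<noteq> topspace (euclidean :: 'b topology)} \<subseteq> L - K"
        by auto
      then have "openin ?P (PiE (- K) ?B)"
        unfolding openin_PiE_gen using fin by (auto intro: finite_subset)
      moreover have "g \<in> PiE (- K) ?B" using g(1) e by (auto simp: PiE_iff)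
      moreover have "h \<in> topspace ?P \<and> ?\<Phi> h \<in> U" if h: "h \<in> PiE (- K) ?B" for h
      proof -
        have "hausdorff_dist (?\<Phi> g x) (?\<Phi> h x) < e" if "x \<in> L" for x
        proof (cases "x \<in> K")
          case True
          then show ?thesis
            using e usco_nonempty[OF MU_usco[OF F]] usco_compact[OF MU_usco[OF F]]
            by (simp add: hausdorff_dist_self_less)
        next
          case False
          then have "dist (g x) (h x) < e" using PiE_mem[OF h, of x] that by simp
          then show ?thesis using False by (simp add: hausdorff_dist_singleton_less_iff)
        qed
        then have "(?\<Phi> g, ?\<Phi> h) \<in> uc_basic L e" by (simp add: uc_basic_iff[OF cv cv])
        then show ?thesis using LU h by (auto simp: PiE_iff)
      qed
      ultimately show "\<exists>T. openin ?P T \<and> g \<in> T \<and> T \<subseteq> {g \<in> topspace ?P. ?\<Phi> g \<in> U}"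
        by (intro exI[of _ "PiE (- K) ?B"]) auto
    qed
  qed
  moreover have "compactin ?P (PiE (- K) C)" using C by (simp add: compactin_PiE)
  ultimately have "compactin tau_uc (?\<Phi> ` PiE (- K) C)" by (rule image_compactin[rotated])
  then show ?thesis unfolding MU_space_def compactin_subtopology using MU by blast
qed

lemma MU_eq_glued_singletons:
  fixes F G :: "'a::t1_space \<Rightarrow> 'b::topological_space set"
  assumes G: "G \<in> MU" and D: "\<And>x. x \<notin> K \<Longrightarrow> open {x}"
    and eq: "\<And>x. x \<in> K \<Longrightarrow> G x = F x" and C: "\<And>x. x \<notin> K \<Longrightarrow> G x \<subseteq> C x"
  shows "G \<in> (\<lambda>g x. if x \<in> K then F x else {g x}) ` PiE (- K) C"
proof -
  have "\<exists>y. G x = {y}" if "x \<notin> K" for x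
    using MU_isolated_singleton[OF G D[OF that]] by metis
  then obtain g where g: "\<And>x. x \<notin> K \<Longrightarrow> G x = {g x}" by metis
  show ?thesis
    by (rule image_eqI[of _ _ "restrict g (- K)"]) (use g eq C in \<open>auto simp: fun_eq_iff\<close>)
qed

text \<open>The set \<open>K\<close> is where maps near \<open>F\<close> have to agree with \<open>F\<close>, and \<open>C\<close> confines their values at
  the isolated points off \<open>K\<close>. For finite \<open>X\<close> this is used with \<open>K = {}\<close>, and for finite \<open>Y\<close> with
  \<open>C\<close> constantly \<open>UNIV\<close>.\<close>

lemma MU_space_compact_nhd:
  fixes F :: "'a::t2_space \<Rightarrow> 'b::metric_space set"
  assumes F: "F \<in> MU" and K: "open K" "closed K" and D: "\<And>x. x \<notin> K \<Longrightarrow> open {x}"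
    and C: "\<And>x. x \<notin> K \<Longrightarrow> compact (C x)" and L: "compact L" "e > 0"
    and near: "\<And>G x. \<lbrakk>G \<in> MU; (F, G) \<in> uc_basic L e\<rbrakk> \<Longrightarrow>
      (if x \<in> K then G x = F x else G x \<subseteq> C x)"
  shows "\<exists>U S. openin MU_space U \<and> compactin MU_space S \<and> F \<in> U \<and> U \<subseteq> S"
proof -
  obtain U where U: "openin MU_space U" "F \<in> U"
    "\<And>G. G \<in> U \<Longrightarrow> G \<in> MU \<and> (F, G) \<in> uc_basic L e"
    using openin_MU_space_ball[OF F L] by blast
  have "U \<subseteq> (\<lambda>g x. if x \<in> K then F x else {g x}) ` PiE (- K) C"
  proof
    fix G assume "G \<in> U"
    then have G: "G \<in> MU" "(F, G) \<in> uc_basic L e" using U(3) by auto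
    have "G x = F x" if "x \<in> K" for x using near[OF G, of x] that by simp
    moreover have "G x \<subseteq> C x" if "x \<notin> K" for x using near[OF G, of x] that by simp
    ultimately show "G \<in> (\<lambda>g x. if x \<in> K then F x else {g x}) ` PiE (- K) C"
      using MU_eq_glued_singletons[OF G(1) D] by blast
  qed
  moreover have "compactin MU_space ((\<lambda>g x. if x \<in> K then F x else {g x}) ` PiE (- K) C)"
    by (rule compactin_glued_singletons[OF F K D C])
  ultimately show ?thesis using U(1,2) by (intro exI conjI)
qed

text \<open>The points of \<open>Y\<close> are isolated but not necessarily uniformly so. Since \<open>F\<close> has only finitely many values
  on \<open>K\<close>, one radius serves all of them.\<close>

lemma MU_near_eq_on_compact:
  fixes F :: "'a::topological_space \<Rightarrow> 'b::metric_space set"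
  assumes F: "usco F" and K: "compact K" and Y: "\<And>y :: 'b. open {y}"
  obtains e where "e > 0" "\<And>G x. \<lbrakk>(F, G) \<in> uc_basic K e; x \<in> K\<rbrakk> \<Longrightarrow> G x = F x"
proof -
  define V where "V = (\<Union>x\<in>K. F x)"
  have fin: "finite V"
    unfolding V_def by (rule finite_compact_of_isolated[OF compact_usco_image[OF F K] Y])
  have "\<exists>e>0. ball y e \<subseteq> {y}" for y :: 'b
    using Y[of y] open_contains_ball by blast
  then obtain r where r: "\<And>y::'b. r y > 0 \<and> ball y (r y) \<subseteq> {y}" by metis
  define e where "e = Min (insert 1 (r ` V))"
  have e: "e > 0" "\<And>v. v \<in> V \<Longrightarrow> e \<le> r v"
    unfolding e_def using fin r by auto
  have iso: "u = v" if "v \<in> V" "dist v u < e" for u v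
  proof -
    have "u \<in> ball v (r v)" using e(2)[OF that(1)] that(2) by simp
    then show ?thesis using r by blast
  qed
  have "G x = F x" if G: "(F, G) \<in> uc_basic K e" and x: "x \<in> K" for G x
  proof -
    have h: "hausdorff_dist (F x) (G x) < e"
      and ne: "F x \<noteq> {}" "G x \<noteq> {}" "compact (F x)" "compact (G x)"
      using G x by (auto simp: uc_basic_def compact_valued_def)
    have V: "F x \<subseteq> V" using x unfolding V_def by blast
    have "\<forall>a\<in>F x. \<exists>b\<in>G x. dist a b < e" "\<forall>b\<in>G x. \<exists>a\<in>F x. dist a b < e"
      using h by (auto simp: hausdorff_dist_less_iff[OF ne] dist_commute)
    then show ?thesis using iso V by blast
  qed
  then show thesis using that e(1) by blast
qed

section \<open>The characterization\<close>

lemma MU_space_compact_if_discrete_compact: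
  assumes X: "\<And>x :: 'a::t2_space. open {x}" and Y: "compact (UNIV :: 'b::metric_space set)"
  shows "compact_space (MU_space :: ('a \<Rightarrow> 'b set) topology)"
proof -
  \<comment> \<open>With \<open>K = {}\<close> the glued maps are all single-valued maps, whatever \<open>?c\<close> is.\<close>
  let ?c = "\<lambda>_ :: 'a. {undefined :: 'b}"
  let ?S = "(\<lambda>g x. if x \<in> {} then ?c x else {g x}) ` PiE (- {}) (\<lambda>_::'a. UNIV :: 'b set)"
  have S: "compactin MU_space ?S"
    by (rule compactin_glued_singletons[OF const_singleton_MU]) (use X Y in auto)
  then have "?S \<subseteq> MU" using compactin_subset_topspace topspace_MU_space by blast
  moreover have "MU \<subseteq> ?S"
    by (rule subsetI, rule MU_eq_glued_singletons) (use X in auto)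
  ultimately have "?S = MU" by (rule subset_antisym)
  then show ?thesis using S unfolding compact_space_def topspace_MU_space by simp
qed

lemma MU_space_discrete_if_compact_discrete:
  assumes X: "compact (UNIV :: 'a::topological_space set)" and Y: "\<And>y :: 'b::metric_space. open {y}"
  shows "(MU_space :: ('a \<Rightarrow> 'b set) topology) = discrete_topology MU"
proof -
  have "openin MU_space {F}" if F: "F \<in> MU" for F :: "'a \<Rightarrow> 'b set"
  proof -
    obtain e where e: "e > 0" "\<And>G x. (F, G) \<in> uc_basic UNIV e \<Longrightarrow> G x = F x"
      using MU_near_eq_on_compact[OF MU_usco[OF F] X Y] by (metis UNIV_I)
    obtain U where U: "openin MU_space U" "F \<in> U"
      "\<And>G. G \<in> U \<Longrightarrow> G \<in> MU \<and> (F, G) \<in> uc_basic UNIV e"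
      using openin_MU_space_ball[OF F X e(1)] by blast
    have "G = F" if "G \<in> U" for G
      by (rule ext) (use U(3)[OF that] e(2) in blast)
    then have "U = {F}" using U(2) by blast
    then show ?thesis using U(1) by simp
  qed
  then show ?thesis
    by (metis discrete_topology_unique topspace_MU_space)
qed

lemma MU_space_locally_compact_if_finite:
  assumes X: "finite (UNIV :: 'a::t2_space set)"
    and Y: "locally_compact_space (euclidean :: 'b::metric_space topology)"
  shows "locally_compact_space (MU_space :: ('a \<Rightarrow> 'b set) topology)"
  unfolding locally_compact_space_def topspace_MU_space
proof
  fix F :: "'a \<Rightarrow> 'b set" assume F: "F \<in> MU"
  have isolated: "open {x}" for x :: 'a
    using open_singleton_if_finite_nhd[OF open_UNIV X] by simp
  have "\<exists>y. F x = {y}" for x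
    using MU_isolated_singleton[OF F isolated] by metis
  then obtain f where f: "\<And>x. F x = {f x}" by metis
  have "\<exists>e C. e > 0 \<and> compact C \<and> ball y e \<subseteq> C" for y :: 'b
  proof -
    obtain U C where "open U" "compact C" "y \<in> U" "U \<subseteq> C"
      using locally_compact_nhd[OF Y] .
    then show ?thesis by (meson open_contains_ball order_trans)
  qed
  then obtain r C where rC: "\<And>y::'b. r y > 0 \<and> compact (C y) \<and> ball y (r y) \<subseteq> C y" by metis
  define e where "e = Min (range (\<lambda>x. r (f x)))"
  have e: "e > 0" "\<And>x. e \<le> r (f x)" unfolding e_def using X rC by auto
  show "\<exists>U S. openin MU_space U \<and> compactin MU_space S \<and> F \<in> U \<and> U \<subseteq> S"
  proof (rule MU_space_compact_nhd[OF F, of "{}" "\<lambda>x. C (f x)" UNIV e])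
    fix G x assume G: "G \<in> MU" "(F, G) \<in> uc_basic UNIV e"
    obtain y where y: "G x = {y}" using MU_isolated_singleton[OF G(1) isolated] .
    have "dist (f x) y < e"
      using G(2) y f by (auto simp: uc_basic_def hausdorff_dist_singleton_less_iff dest: spec[of _ x])
    then show "if x \<in> {} then G x = F x else G x \<subseteq> C (f x)"
      using e(2)[of x] rC[of "f x"] y by auto
  qed (use isolated rC e X finite_imp_compact in auto)
qed

lemma MU_space_locally_compact_if_sum:
  assumes Y: "finite (UNIV :: 'b::metric_space set)"
    and X: "sum_of_compact_and_discrete TYPE('a::t2_space)"
  shows "locally_compact_space (MU_space :: ('a \<Rightarrow> 'b set) topology)"
  unfolding locally_compact_space_def topspace_MU_space
proof
  fix F :: "'a \<Rightarrow> 'b set" assume F: "F \<in> MU"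
  obtain K D :: "'a set" where KD: "open K" "open D" "K \<inter> D = {}" "K \<union> D = UNIV" "compact K"
    and "top_of_set D = discrete_topology D"
    using X unfolding sum_of_compact_and_discrete_def by blast
  then have isolated: "open {x}" if "x \<notin> K" for x
    using that top_of_set_eq_discrete_iff[of D] by blast
  have "open {y}" for y :: 'b
    using open_singleton_if_finite_nhd[OF open_UNIV Y] by simp
  then obtain e where e: "e > 0" "\<And>G x. \<lbrakk>(F, G) \<in> uc_basic K e; x \<in> K\<rbrakk> \<Longrightarrow> G x = F x"
    using MU_near_eq_on_compact[OF MU_usco[OF F] \<open>compact K\<close>] by blast
  show "\<exists>U S. openin MU_space U \<and> compactin MU_space S \<and> F \<in> U \<and> U \<subseteq> S"
    by (rule MU_space_compact_nhd[OF F, of K "\<lambda>_. UNIV" K e])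
      (use KD isolated e Y finite_imp_compact compact_imp_closed in auto)
qed

text \<open>At a constant map the Hausdorff distance disappears: being close to the constant \<open>y\<close> on \<open>K\<close>
  just means that all values on \<open>K\<close> lie near \<open>y\<close>.\<close>

lemma MU_space_locally_compact_at_const:
  fixes y :: "'b::metric_space"
  assumes "locally_compact_space (MU_space :: ('a \<Rightarrow> 'b set) topology)"
  obtains \<C> :: "('a::topological_space \<Rightarrow> 'b set) set" and K e where "compactin tau_uc \<C>" "compact K" "e > 0"
    "\<And>F. \<lbrakk>F \<in> MU; \<And>x v. \<lbrakk>x \<in> K; v \<in> F x\<rbrakk> \<Longrightarrow> dist v y < e\<rbrakk> \<Longrightarrow> F \<in> \<C>"
proof -
  let ?c = "\<lambda>_ :: 'a. {y}"
  have c: "?c \<in> MU" by (rule const_singleton_MU)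
  obtain U \<C> where U: "openin MU_space U" "compactin MU_space \<C>" "?c \<in> U" "U \<subseteq> \<C>"
    using assms c unfolding locally_compact_space_def topspace_MU_space by blast
  obtain T where T: "openin tau_uc T" "U = T \<inter> MU"
    using U(1) unfolding MU_space_def openin_subtopology by blast
  have "?c \<in> T" using U(3) T(2) by blast
  then obtain K e where Ke: "compact K" "e > 0" "\<And>G. (?c, G) \<in> uc_basic K e \<Longrightarrow> G \<in> T"
    using T(1) unfolding openin_tau_uc_iff by meson
  have "F \<in> \<C>" if F: "F \<in> MU" and near: "\<And>x v. \<lbrakk>x \<in> K; v \<in> F x\<rbrakk> \<Longrightarrow> dist v y < e" for F
  proof -
    have ne: "F x \<noteq> {}" "compact (F x)" for x
      using MU_usco[OF F] by (auto simp: usco_def)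
    have "hausdorff_dist {y} (F x) < e" if "x \<in> K" for x
      using near[OF that] ne[of x] by (auto simp: hausdorff_dist_less_iff dist_commute)
    then have "(?c, F) \<in> uc_basic K e"
      using F c MU_subset_compact_valued by (subst uc_basic_iff) blast+
    then show ?thesis using Ke(3) T(2) U(4) F by blast
  qed
  moreover have "compactin tau_uc \<C>"
    using U(2) unfolding MU_space_def compactin_subtopology by blast
  ultimately show thesis using that Ke by blast
qed

lemma locally_compact_codomain:
  assumes "locally_compact_space (MU_space :: ('a::topological_space \<Rightarrow> 'b::metric_space set) topology)"
  shows "locally_compact_space (euclidean :: 'b topology)"
  unfolding locally_compact_space_def
proof
  fix y :: 'b
  obtain \<C> :: "('a \<Rightarrow> 'b set) set" and K e where \<C>: "compactin tau_uc \<C>" "e > 0"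
    "\<And>F. \<lbrakk>F \<in> MU; \<And>x v. \<lbrakk>x \<in> K; v \<in> F x\<rbrakk> \<Longrightarrow> dist v y < e\<rbrakk> \<Longrightarrow> F \<in> \<C>"
    using MU_space_locally_compact_at_const[OF assms, of y] by metis
  have "(\<lambda>_. {v}) \<in> \<C>" if "v \<in> cball y (e/2)" for v
    using that \<C>(2) by (intro \<C>(3) const_singleton_MU) (auto simp: dist_commute)
  then have "compact (cball y (e/2))"
    by (intro compact_if_singletons_attained[OF \<C>(1)]) auto
  then show "\<exists>U K. openin euclidean U \<and> compactin euclidean K \<and> y \<in> U \<and> U \<subseteq> K"
    using \<C>(2) by (intro exI[of _ "ball y (e/2)"] exI[of _ "cball y (e/2)"]) auto
qed

text \<open>If \<open>y\<close> is not isolated, another point \<open>z\<close> lies so close to it that all separating maps with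
  values in \<open>{y, z}\<close> belong to one compact family.\<close>

lemma finite_compact_subsets_if_codomain_not_discrete:
  fixes y :: "'b::metric_space" and L :: "'a::t2_space set"
  assumes lc: "locally_compact_space (MU_space :: ('a \<Rightarrow> 'b set) topology)"
    and y: "\<not> open {y}" and L: "compact L"
  shows "finite L"
proof -
  obtain \<C> :: "('a \<Rightarrow> 'b set) set" and K e where \<C>: "compactin tau_uc \<C>" "e > 0"
    "\<And>F. \<lbrakk>F \<in> MU; \<And>x v. \<lbrakk>x \<in> K; v \<in> F x\<rbrakk> \<Longrightarrow> dist v y < e\<rbrakk> \<Longrightarrow> F \<in> \<C>"
    using MU_space_locally_compact_at_const[OF lc, of y] by metis
  have "ball y e \<noteq> {y}" using y open_ball[of y e] by metis
  moreover have "y \<in> ball y e" using \<C>(2) by simp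
  ultimately obtain z where "z \<noteq> y" "z \<in> ball y e" by blast
  then have z: "z \<noteq> y" "dist z y < e" by (auto simp: dist_commute)
  have "finite (L \<inter> UNIV)"
  proof (rule finite_if_separated_by_compact_family[OF \<C>(1) L z(1)])
    fix p q :: 'a assume "p \<noteq> q"
    then obtain F where F: "F \<in> MU" "F p = {z}" "F q = {y}" "\<And>x. F x \<subseteq> {z, y}"
      using MU_separating_point[of "{q}" p z y] by auto
    have "F \<in> \<C>" using F(4) z(2) \<C>(2) by (intro \<C>(3)[OF F(1)]) fastforce
    then show "\<exists>F\<in>\<C>. F p = {z} \<and> F q = {y}" using F by blast
  qed
  then show ?thesis by simp
qed

text \<open>The neighbourhood of a constant map restricts maps on a compact set \<open>K\<close> only, so at a point
  off \<open>K\<close> every value can occur.\<close>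

lemma compact_codomain_if_domain_not_compact:
  assumes lc: "locally_compact_space (MU_space :: ('a::t2_space \<Rightarrow> 'b::metric_space set) topology)"
    and X: "\<not> compact (UNIV :: 'a set)"
  shows "compact (UNIV :: 'b set)"
proof -
  fix y :: 'b
  obtain \<C> :: "('a \<Rightarrow> 'b set) set" and K e where \<C>: "compactin tau_uc \<C>" "compact K" "e > 0"
    "\<And>F. \<lbrakk>F \<in> MU; \<And>x v. \<lbrakk>x \<in> K; v \<in> F x\<rbrakk> \<Longrightarrow> dist v y < e\<rbrakk> \<Longrightarrow> F \<in> \<C>"
    using MU_space_locally_compact_at_const[OF lc, of y] by metis
  obtain p where p: "p \<notin> K" using X \<C>(2) by (metis UNIV_eq_I)
  have "\<exists>F\<in>\<C>. F p = {v}" for v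
  proof -
    obtain F where F: "F \<in> MU" "F p = {v}" "\<And>x. x \<in> K \<Longrightarrow> F x = {y}"
      using MU_separating_point[OF \<C>(2) p, of v y] by metis
    then have "F \<in> \<C>" using \<C>(3) by (intro \<C>(4)) auto
    then show ?thesis using F(2) by blast
  qed
  then show ?thesis by (intro compact_if_singletons_attained[OF \<C>(1)]) auto
qed

text \<open>Two points off \<open>K\<close> are separated by a map that is constant on \<open>K\<close>, hence belongs to the
  compact family. So compact sets are finite off \<open>K\<close>, which makes the points off \<open>K\<close> isolated.
  As \<open>K\<close> itself need not be open, it is enlarged to a compact neighbourhood; this adds only
  finitely many points, all of them isolated.\<close>

lemma sum_if_MU_space_locally_compact:
  fixes y z :: "'b::metric_space"
  assumes X: "locally_compact_space (euclidean :: 'a::t2_space topology)"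
    and lc: "locally_compact_space (MU_space :: ('a \<Rightarrow> 'b set) topology)"
    and yz: "y \<noteq> z"
  shows "sum_of_compact_and_discrete TYPE('a)"
proof -
  obtain \<C> :: "('a \<Rightarrow> 'b set) set" and K e where \<C>: "compactin tau_uc \<C>" "compact K" "e > 0"
    "\<And>F. \<lbrakk>F \<in> MU; \<And>x v. \<lbrakk>x \<in> K; v \<in> F x\<rbrakk> \<Longrightarrow> dist v z < e\<rbrakk> \<Longrightarrow> F \<in> \<C>"
    using MU_space_locally_compact_at_const[OF lc, of z] by metis
  have fin: "finite (L \<inter> - K)" if L: "compact L" for L
  proof (rule finite_if_separated_by_compact_family[OF \<C>(1) L yz])
    fix p q assume pq: "p \<in> - K" "q \<in> - K" "p \<noteq> q"
    have qK: "compact (insert q K)" "p \<notin> insert q K" using pq \<C>(2) by auto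
    obtain F where F: "F \<in> MU" "F p = {y}" "\<And>x. x \<in> insert q K \<Longrightarrow> F x = {z}"
      using MU_separating_point[OF qK, of y z] by metis
    then have "F \<in> \<C>" using \<C>(3) by (intro \<C>(4)) auto
    then show "\<exists>F\<in>\<C>. F p = {y} \<and> F q = {z}" using F by blast
  qed
  have isolated: "open {p}" if p: "p \<notin> K" for p
  proof -
    obtain U L where UL: "open U" "compact L" "p \<in> U" "U \<subseteq> L"
      using locally_compact_nhd[OF X] .
    have "open (U - K)" using UL(1) \<C>(2) by (intro open_Diff compact_imp_closed)
    moreover have "finite (U - K)" using fin[OF UL(2)] UL(4) by (auto elim: finite_subset[rotated])
    ultimately show ?thesis using open_singleton_if_finite_nhd p UL(3) by blast
  qed
  have "\<exists>U L. open U \<and> compact L \<and> K \<subseteq> U \<and> U \<subseteq> L"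
    using X \<C>(2) Hausdorff_space_euclidean_t2
      locally_compact_space_compact_closed_compact[of "euclidean :: 'a topology"]
    unfolding compactin_euclidean_iff open_openin[symmetric] by metis
  then obtain U L where UL: "open U" "compact L" "K \<subseteq> U" "U \<subseteq> L" by blast
  have "L = U \<union> (\<Union>x\<in>L - K. {x})" using UL by auto
  moreover have "open \<dots>" using UL(1) isolated by (intro open_Un open_UN) auto
  ultimately have "open L" by simp
  moreover have "open (- L)" using compact_imp_closed[OF UL(2)] by blast
  moreover from this have "top_of_set (- L) = discrete_topology (- L)"
    using isolated UL by (subst top_of_set_eq_discrete_iff) auto
  ultimately show ?thesis
    unfolding sum_of_compact_and_discrete_def using UL(2)
    by (intro exI[of _ L] exI[of _ "- L"]) auto
qed

theorem theorem3p12: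
  assumes "locally_compact_space (euclidean :: 'a::t2_space topology)"
    and "\<exists>y z :: 'b::metric_space. y \<noteq> z"
  shows "(locally_compact_space (MU_space :: ('a \<Rightarrow> 'b set) topology) \<longleftrightarrow>
            (compact (UNIV :: 'b set) \<and>
               (euclidean :: 'a topology) = discrete_topology UNIV) \<or>
            ((euclidean :: 'b topology) = discrete_topology UNIV \<and>
               compact (UNIV :: 'a set)) \<or>
            (locally_compact_space (euclidean :: 'b topology) \<and>
               finite (UNIV :: 'a set)) \<or>
            (finite (UNIV :: 'b set) \<and> sum_of_compact_and_discrete TYPE('a))) \<and>
         (compact (UNIV :: 'b set) \<and> (euclidean :: 'a topology) = discrete_topology UNIV
            \<longrightarrow> compact_space (MU_space :: ('a \<Rightarrow> 'b set) topology)) \<and>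
         ((euclidean :: 'b topology) = discrete_topology UNIV \<and> compact (UNIV :: 'a set)
            \<longrightarrow> (MU_space :: ('a \<Rightarrow> 'b set) topology) = discrete_topology MU)"
proof -
  let ?M = "MU_space :: ('a \<Rightarrow> 'b set) topology"
  let ?dX = "(euclidean :: 'a topology) = discrete_topology UNIV"
  let ?dY = "(euclidean :: 'b topology) = discrete_topology UNIV"
  let ?cX = "compact (UNIV :: 'a set)" and ?cY = "compact (UNIV :: 'b set)"
  let ?lY = "locally_compact_space (euclidean :: 'b topology)"
  let ?sum = "finite (UNIV :: 'b set) \<and> sum_of_compact_and_discrete TYPE('a)"
  have compact: "compact_space ?M" if "?cY \<and> ?dX"
    using that MU_space_compact_if_discrete_compact by (auto simp: euclidean_eq_discrete_iff)
  have discrete: "?M = discrete_topology MU" if "?dY \<and> ?cX"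
    using that MU_space_discrete_if_compact_discrete by (auto simp: euclidean_eq_discrete_iff)
  have "(?cY \<and> ?dX) \<or> (?dY \<and> ?cX) \<or> (?lY \<and> finite (UNIV :: 'a set)) \<or> ?sum"
    if lc: "locally_compact_space ?M"
  proof (cases ?dY)
    case True
    show ?thesis
    proof (cases ?cX)
      case False
      then have "finite (UNIV :: 'b set)"
        using finite_compact_of_isolated[OF compact_codomain_if_domain_not_compact[OF lc]] True
        by (auto simp: euclidean_eq_discrete_iff)
      then show ?thesis
        using sum_if_MU_space_locally_compact[OF assms(1) lc] assms(2) by blast
    qed (use True in blast)
  next
    case False
    then have fin: "finite L" if "compact L" for L :: "'a set"
      using finite_compact_subsets_if_codomain_not_discrete[OF lc _ that]
      by (auto simp: euclidean_eq_discrete_iff)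
    show ?thesis
    proof (cases ?cX)
      case True
      then show ?thesis using fin locally_compact_codomain[OF lc] by blast
    next
      case False
      have "open {x}" for x :: 'a
      proof -
        obtain U L where "open U" "compact L" "x \<in> U" "U \<subseteq> L"
          using locally_compact_nhd[OF assms(1)] .
        then show ?thesis
          using fin open_singleton_if_finite_nhd finite_subset by metis
      qed
      then show ?thesis
        using compact_codomain_if_domain_not_compact[OF lc False]
        by (simp add: euclidean_eq_discrete_iff)
    qed
  qed
  moreover have "locally_compact_space ?M" if "?cY \<and> ?dX"
    using compact[OF that] by (rule compact_imp_locally_compact_space)
  moreover have "locally_compact_space ?M" if "?dY \<and> ?cX"
    by (subst discrete[OF that]) (rule locally_compact_space_discrete_topology)
  moreover have "locally_compact_space ?M" if "?lY \<and> finite (UNIV :: 'a set)"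
    using that MU_space_locally_compact_if_finite by blast
  moreover have "locally_compact_space ?M" if ?sum
    using that MU_space_locally_compact_if_sum by blast
  ultimately show ?thesis using compact discrete by blast
qed

end
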